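(* Let $(D,h,g)$ be topologically labeled data with $h: D \to \mathcal{D} \subset \mathbb{R}^{d_{in}}$, where $\mathcal{D}=h(D)$, and $g: \mathcal{D}_L \to \mathcal{Y}$, where $\mathcal{Y}$ is a finite label set and $\mathcal{D}_L\subset\mathcal{D}$ is closed. Then for every integer $k \geq 1$ there exists a continuous map $f: \mathbb{R}^{d_{in}} \to \mathbb{R}^k$ that separates $(D,h,g)$.
   Context: Topological data with ambient space $E$ is a pair $(D,h)$ where $D = M_1 \sqcup \cdots \sqcup M_r$ is a disjoint union of finitely many compact manifolds (possibly of different dimensions, boundary allowed) and $h: D \to E$ is continuous; write $\mathcal{D}=h(D)\subset E$. Let $\mathcal{Y}=\{l_1,\dots,l_m\}$ be a finite set of $m$ distinct labels with the discrete topology. A topological labeling on $\mathcal{D}$ is a closed subset $\mathcal{D}_L\subset\mathcal{D}$ together with a surjective continuous function $g:\mathcal{D}_L\to\mathcal{Y}$. The triple $(D,h,g)$ is then called topologically labeled data. Write $\mathcal{D}_i=g^{-1}(l_i)$ for $1\le i\le m$. For topologically labeled data with ambient space $E=\mathbb{R}^{n}$, a continuous function $f:\mathbb{R}^{n}\to\mathbb{R}^k$ separates $(D,h,g)$ if there exist $m=|\mathcal{Y}|$ pairwise disjoint embedded $k$-dimensional discs $A_1,\dots,A_m$ in $\mathbb{R}^k$ such that $f(\mathcal{D}_i)\subset A_i$ for every $1\le i\le m$. An embedded $k$-dimensional disc in $\mathbb{R}^k$ is the image of the closed unit ball of $\mathbb{R}^k$ under a topological embedding into $\mathbb{R}^k$.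 *)

theory Defs
  imports "HOL-Analysis.Analysis"
begin

(* Library Euclidean_space n consists of the sequences vanishing from index n on, so the
   distinguished coordinate is x 0.  For n = 0 the inequality is vacuous and the half space
   is a point. *)
definition half_space :: "nat \<Rightarrow> (nat \<Rightarrow> real) topology" where
  "half_space n = subtopology (Euclidean_space n) {x. x 0 \<ge> 0}"

definition manifold_with_boundary :: "nat \<Rightarrow> 'a topology \<Rightarrow> bool" where
  "manifold_with_boundary n X \<longleftrightarrow>
     Hausdorff_space X \<and> second_countable X \<and>
     (\<forall>x\<in>topspace X. \<exists>U V. openin X U \<and> x \<in> U \<and> openin (half_space n) V \<and>
        subtopology X U homeomorphic_space subtopology (half_space n) V)"

(* The domain D is the disjoint union sum_topology M {..<r} of M 0, ..., M (r - 1).  All the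
   summands live on one carrier type 'a, which is arbitrary. *)
definition topological_data ::
    "nat \<Rightarrow> (nat \<Rightarrow> 'a topology) \<Rightarrow> (nat \<times> 'a \<Rightarrow> 'e::topological_space) \<Rightarrow> bool" where
  "topological_data r M h \<longleftrightarrow>
     (\<forall>i<r. compact_space (M i) \<and> (\<exists>n. manifold_with_boundary n (M i))) \<and>
     continuous_map (sum_topology M {..<r}) euclidean h"

definition topological_labeling ::
    "'e::topological_space set \<Rightarrow> 'l set \<Rightarrow> 'e set \<Rightarrow> ('e \<Rightarrow> 'l) \<Rightarrow> bool" where
  "topological_labeling S Y S\<^sub>L g \<longleftrightarrow>
     finite Y \<and> closedin (top_of_set S) S\<^sub>L \<and>
     continuous_map (top_of_set S\<^sub>L) (discrete_topology Y) g \<and> g ` S\<^sub>L = Y"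

definition topologically_labeled_data ::
    "nat \<Rightarrow> (nat \<Rightarrow> 'a topology) \<Rightarrow> (nat \<times> 'a \<Rightarrow> 'e::topological_space) \<Rightarrow>
     'l set \<Rightarrow> 'e set \<Rightarrow> ('e \<Rightarrow> 'l) \<Rightarrow> bool" where
  "topologically_labeled_data r M h Y S\<^sub>L g \<longleftrightarrow>
     topological_data r M h \<and>
     topological_labeling (h ` topspace (sum_topology M {..<r})) Y S\<^sub>L g"

definition embedded_disc :: "(real ^ 'k) set \<Rightarrow> bool" where
  "embedded_disc A \<longleftrightarrow>
     (\<exists>\<phi> :: real ^ 'k \<Rightarrow> real ^ 'k.
        embedding_map (top_of_set (cball 0 1)) euclidean \<phi> \<and> A = \<phi> ` cball 0 1)"

(* The discs are indexed by the labels themselves.  Separation depends on the data (D, h, g)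
   only through the labeling g, whose domain and label set are explicit arguments. *)
definition separates ::
    "'l set \<Rightarrow> (real ^ 'n) set \<Rightarrow> (real ^ 'n \<Rightarrow> 'l) \<Rightarrow> (real ^ 'n \<Rightarrow> real ^ 'k) \<Rightarrow> bool" where
  "separates Y S\<^sub>L g f \<longleftrightarrow>
     continuous_on UNIV f \<and>
     (\<exists>A. (\<forall>l\<in>Y. embedded_disc (A l)) \<and> disjoint_family_on A Y \<and>
          (\<forall>l\<in>Y. f ` {x \<in> S\<^sub>L. g x = l} \<subseteq> A l))"

end

theory Submission
  imports Defs
begin

text \<open>The domain is compact, hence so is its image, and the labeled set is closed in Euclidean
  space. Placing the labels at points of mutual distance at least 3, the labeling becomes a
  continuous map into Euclidean space, which extends by Tietze's theorem; the discs are unit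
  balls around those points.\<close>

text \<open>The sum is the finite union of the images of its summands under the continuous
  injections \<open>Pair i\<close>.\<close>

lemma compact_space_sum_topology:
  assumes "finite I" and "\<And>i. i \<in> I \<Longrightarrow> compact_space (X i)"
  shows "compact_space (sum_topology X I)"
proof -
  have "compactin (sum_topology X I) (\<Union>i\<in>I. Pair i ` topspace (X i))"
  proof (rule compactin_Union)
    fix S assume "S \<in> (\<lambda>i. Pair i ` topspace (X i)) ` I"
    then obtain i where i: "i \<in> I" "S = Pair i ` topspace (X i)"
      by blast
    have "compactin (X i) (topspace (X i))"
      using assms(2) i(1) by (simp add: compact_space_def)
    then show "compactin (sum_topology X I) S"
      unfolding i(2) using continuous_map_component_injection[OF i(1)] by (rule image_compactin)
  qed (use assms(1) in simp)
  moreover have "(\<Union>i\<in>I. Pair i ` topspace (X i)) = topspace (sum_topology X I)"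
    by (auto simp: Sigma_def)
  ultimately show ?thesis
    by (simp add: compact_space_def)
qed

text \<open>Translation by \<open>c\<close> is a homeomorphism from the unit ball at the origin,
  with inverse translation by \<open>- c\<close>.\<close>

lemma embedded_disc_cball:
  fixes c :: "real ^ 'k"
  shows "embedded_disc (cball c 1)"
proof -
  have image: "(+) c ` cball 0 1 = cball c 1"
    using cball_translation[of c 0 1] by simp
  have "homeomorphism (cball c 1) (cball 0 1) ((+) (- c)) ((+) c)"
    using homeomorphism_translation[of c "cball 0 1"] unfolding image .
  then have "homeomorphic_maps (top_of_set (cball 0 1)) (top_of_set (cball c 1)) ((+) c) ((+) (- c))"
    unfolding homeomorphism_def homeomorphic_maps_def by (auto simp: dist_norm)
  then have "homeomorphic_map (top_of_set (cball 0 1)) (top_of_set (cball c 1)) ((+) c)"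
    unfolding homeomorphic_map_maps by blast
  then show ?thesis
    unfolding embedded_disc_def embedding_map_def using image
    by (intro exI[of _ "(+) c"]) simp
qed

text \<open>Numbering the labels by distinct naturals allows all centres to lie on one line, in the
  direction of a basis vector.\<close>

lemma finite_imp_unit_cballs_disjoint:
  fixes Y :: "'l set"
  assumes "finite Y"
  obtains q :: "'l \<Rightarrow> 'a::euclidean_space" where "disjoint_family_on (\<lambda>l. cball (q l) 1) Y"
proof -
  obtain i :: "'l \<Rightarrow> nat" where i: "inj_on i Y"
    using finite_imp_inj_to_nat_seg[OF assms] by blast
  \<comment> \<open>The assumption k >= 1 enters here: it is built into the type, since a Euclidean
    space has a nonempty basis.\<close>
  obtain b :: 'a where b: "b \<in> Basis"
    using nonempty_Basis by blast
  \<comment> \<open>Any spacing above 2, the sum of two radii, would do.\<close>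
  define q where "q l = (3 * real (i l)) *\<^sub>R b" for l
  have "cball (q l) 1 \<inter> cball (q l') 1 = {}" if "l \<in> Y" "l' \<in> Y" "l \<noteq> l'" for l l'
  proof -
    have "i l \<noteq> i l'"
      using i that by (auto dest: inj_onD)
    then have "1 \<le> \<bar>real (i l) - real (i l')\<bar>"
      by linarith
    moreover have "dist (q l) (q l') = 3 * \<bar>real (i l) - real (i l')\<bar>"
    proof -
      have "q l - q l' = (3 * (real (i l) - real (i l'))) *\<^sub>R b"
        by (simp add: q_def algebra_simps)
      then show ?thesis
        \<comment> \<open>The product with 3 must stay factored for \<open>abs_mult\<close> to
          apply.\<close>
        using b by (simp add: dist_norm abs_mult del: right_diff_distrib_numeral)
    qed
    ultimately have "1 + 1 < dist (q l) (q l')"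
      by (smt (verit))
    then show ?thesis
      by (rule disjoint_cballI)
  qed
  then show ?thesis
    using that[of q] by (auto simp: disjoint_family_on_def)
qed

theorem theorem5p4:
  fixes M :: "nat \<Rightarrow> 'a topology"
    and h :: "nat \<times> 'a \<Rightarrow> real ^ 'd"
    and Y :: "'l set"
    and D\<^sub>L :: "(real ^ 'd) set"
    and g :: "real ^ 'd \<Rightarrow> 'l"
  assumes "topologically_labeled_data r M h Y D\<^sub>L g"
  shows "\<exists>f :: real ^ 'd \<Rightarrow> real ^ 'k. separates Y D\<^sub>L g f"
proof -
  let ?D = "sum_topology M {..<r}"
  have M: "\<And>i. i < r \<Longrightarrow> compact_space (M i)"
    and h: "continuous_map ?D euclidean h"
    and Y: "finite Y"
    and D\<^sub>L: "closedin (top_of_set (h ` topspace ?D)) D\<^sub>L"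
    and g: "continuous_map (top_of_set D\<^sub>L) (discrete_topology Y) g"
    using assms
    unfolding topologically_labeled_data_def topological_data_def topological_labeling_def
    by auto
  have "compact_space ?D"
    using M by (intro compact_space_sum_topology) auto
  then have "compact (h ` topspace ?D)"
    using image_compactin[OF _ h] by (simp add: compact_space_def flip: compactin_euclidean_iff)
  \<comment> \<open>The labeled set is given as closed only relative to the image of
    \<open>h\<close>; compactness of that image makes it closed in the whole space, as Tietze's
    theorem requires.\<close>
  with D\<^sub>L have closed: "closed D\<^sub>L"
    using closedin_compact compact_imp_closed by blast
  obtain q :: "'l \<Rightarrow> real ^ 'k" where q: "disjoint_family_on (\<lambda>l. cball (q l) 1) Y"
    using finite_imp_unit_cballs_disjoint[OF Y] .
  \<comment> \<open>Every map out of a discrete space is continuous.\<close>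
  have "continuous_map (discrete_topology Y) euclidean q"
    by simp
  with g have "continuous_map (top_of_set D\<^sub>L) euclidean (q \<circ> g)"
    by (rule continuous_map_compose)
  then have "continuous_on D\<^sub>L (q \<circ> g)"
    by simp
  then obtain f where f: "continuous_on UNIV f" "\<And>x. x \<in> D\<^sub>L \<Longrightarrow> f x = (q \<circ> g) x"
    using Tietze_unbounded[of D\<^sub>L "q \<circ> g" UNIV] closed by auto
  \<comment> \<open>On the labeled set \<open>f\<close> equals \<open>q \<circ> g\<close>, so all
    points labeled \<open>l\<close> go to the centre \<open>q l\<close> of their disc.\<close>
  have "separates Y D\<^sub>L g f"
    unfolding separates_def
    using f q by (intro conjI exI[of _ "\<lambda>l. cball (q l) 1"]) (auto simp: embedded_disc_cball)
  then show ?thesis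
    by blast
qed

end
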